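(* For every $k\ge 5$ there is $t_0(k)$ such that for all $t\ge t_0(k)$, $R^k(BK_t,BK_t)=t$. For $k=5$, $t_0=23$ suffices.
   Context: For a graph $G=(V,E)$ and an integer $r\ge 2$, $BG$ (the set of Berge copies of $G$) is the set of $r$-uniform hypergraphs $\mathcal{H}'$ for which there exist an injection $\phi: V\to V(\mathcal{H}')$ and a bijection $\psi: E\to E(\mathcal{H}')$ such that $\{\phi(u),\phi(v)\}\subseteq \psi(uv)$ for every edge $uv\in E$. $K_n$ denotes the complete graph on $n$ vertices. For collections $\mathcal{F}_1,\mathcal{F}_2$ of $r$-uniform hypergraphs, $R^r(\mathcal{F}_1,\mathcal{F}_2)$ is the least $N$ such that every 2-coloring of the hyperedges of the complete $r$-uniform hypergraph on $N$ vertices contains a subhypergraph of the first color isomorphic to a member of $\mathcal{F}_1$ or one of the second color isomorphic to a member of $\mathcal{F}_2$. Here $r=k$. *)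

theory Defs
  imports "HOL-Library.Ramsey" "HOL-Library.Extended_Nat"
begin

text \<open>A (hyper)graph is a pair of a vertex set and an edge set; a graph is a 2-uniform hypergraph.\<close>

type_synonym 'a hypergraph = "'a set \<times> 'a set set"

abbreviation verts :: "'a hypergraph \<Rightarrow> 'a set" where
  "verts H \<equiv> fst H"

abbreviation edges :: "'a hypergraph \<Rightarrow> 'a set set" where
  "edges H \<equiv> snd H"

definition uniform_hypergraph :: "nat \<Rightarrow> 'a hypergraph \<Rightarrow> bool" where
  "uniform_hypergraph r H \<longleftrightarrow> finite (verts H) \<and> edges H \<subseteq> nsets (verts H) r"

definition complete_hypergraph :: "nat \<Rightarrow> nat \<Rightarrow> nat hypergraph" where
  "complete_hypergraph r n = ({..<n}, nsets {..<n} r)"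

definition complete_graph :: "nat \<Rightarrow> nat hypergraph" where
  "complete_graph n = complete_hypergraph 2 n"

definition subhypergraph :: "'a hypergraph \<Rightarrow> 'a hypergraph \<Rightarrow> bool" where
  "subhypergraph H' H \<longleftrightarrow>
     verts H' \<subseteq> verts H \<and> edges H' \<subseteq> edges H \<and> (\<forall>e\<in>edges H'. e \<subseteq> verts H')"

definition isomorphic :: "'a hypergraph \<Rightarrow> 'b hypergraph \<Rightarrow> bool" where
  "isomorphic H H' \<longleftrightarrow>
     (\<exists>f. bij_betw f (verts H) (verts H') \<and> edges H' = (\<lambda>e. f ` e) ` edges H)"

text \<open>The vertices of the Berge copies range over the naturals: every finite hypergraph is
  isomorphic to one of this kind, and Ramsey numbers use the copies up to isomorphism only.\<close>

definition berge :: "nat \<Rightarrow> 'a hypergraph \<Rightarrow> nat hypergraph set" where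
  "berge r G = {H. uniform_hypergraph r H \<and>
     (\<exists>\<phi> \<psi>. inj_on \<phi> (verts G) \<and> \<phi> ` verts G \<subseteq> verts H \<and>
        bij_betw \<psi> (edges G) (edges H) \<and>
        (\<forall>u v. {u, v} \<in> edges G \<longrightarrow> {\<phi> u, \<phi> v} \<subseteq> \<psi> {u, v}))}"

definition contains_coloured ::
  "nat hypergraph \<Rightarrow> (nat set \<Rightarrow> nat) \<Rightarrow> nat \<Rightarrow> nat hypergraph set \<Rightarrow> bool" where
  "contains_coloured K c i \<F> \<longleftrightarrow>
     (\<exists>H. subhypergraph H K \<and> (\<forall>e\<in>edges H. c e = i) \<and> (\<exists>F\<in>\<F>. isomorphic H F))"

definition ramsey_arrow ::
  "nat \<Rightarrow> nat \<Rightarrow> nat hypergraph set \<Rightarrow> nat hypergraph set \<Rightarrow> bool" where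
  "ramsey_arrow N r \<F>1 \<F>2 \<longleftrightarrow>
     (\<forall>c \<in> edges (complete_hypergraph r N) \<rightarrow> {0, 1}.
        contains_coloured (complete_hypergraph r N) c 0 \<F>1 \<or>
        contains_coloured (complete_hypergraph r N) c 1 \<F>2)"

text \<open>The infimum in the extended naturals is the least such \<open>N\<close> if there is one, and is infinite
  otherwise.\<close>

definition ramsey_number :: "nat \<Rightarrow> nat hypergraph set \<Rightarrow> nat hypergraph set \<Rightarrow> enat" where
  "ramsey_number r \<F>1 \<F>2 = Inf {enat N | N. ramsey_arrow N r \<F>1 \<F>2}"

end

theory Submission
  imports Defs
begin

text \<open>By Hall's theorem a colouring without a monochromatic Berge \<open>K\<^sub>t\<close> on the whole vertex set
  provides, for each colour, a set of pairs lying in fewer edges of this colour than it has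
  elements. Call these sets \<open>S\<close> and \<open>T\<close>, with \<open>T\<close> the smaller one. Every edge containing a pair
  of \<open>S\<close> and a pair of \<open>T\<close> is counted for one of the colours, so there are fewer than
  \<open>|S| + |T|\<close> such edges. But if \<open>q \<in> T\<close>, then each pair \<open>p \<noteq> q\<close> lies together with \<open>q\<close> in at least
  \<open>t - 4\<close> edges, while each edge containing \<open>q\<close> contains only \<open>(k choose 2) - 1\<close> further pairs;
  for \<open>t \<ge> 2 (k choose 2) + 3\<close> this forces at least \<open>2 |S|\<close> edges. For \<open>k = 5\<close> the bound is 23.\<close>

section \<open>Hall's marriage theorem for finite families\<close>

lemma hall_marriage:
  assumes "finite I" and "\<And>i. i \<in> I \<Longrightarrow> finite (A i)"
    and "\<And>J. J \<subseteq> I \<Longrightarrow> card J \<le> card (\<Union>(A ` J))"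
  shows "\<exists>f. inj_on f I \<and> (\<forall>i\<in>I. f i \<in> A i)"
  using assms
proof (induction "card I" arbitrary: I A rule: less_induct)
  case less
  note fin = less.prems(1) and finA = less.prems(2) and hall = less.prems(3)
  have fin_Union: "finite (\<Union>(A ` J))" if "J \<subseteq> I" for J
    using that fin finA by (auto intro: finite_subset)
  \<comment> \<open>If some proper nonempty subfamily is tight, it and its complement are matched
    separately; otherwise every such subfamily has an element to spare, and one index can be matched
    arbitrarily.\<close>
  consider "I = {}"
    | (tight) J where "J \<subset> I" "J \<noteq> {}" "card (\<Union>(A ` J)) = card J"
    | (slack) "I \<noteq> {}" "\<And>J. J \<subset> I \<Longrightarrow> J \<noteq> {} \<Longrightarrow> card J < card (\<Union>(A ` J))"
    using hall by (metis le_neq_implies_less psubsetE)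
  then show ?case
  proof cases
    case 1
    then show ?thesis by simp
  next
    case tight
    let ?U = "\<Union>(A ` J)"
    have J: "J \<subseteq> I" "finite J" "finite ?U"
      using tight fin fin_Union finite_subset by auto
    have "\<exists>f. inj_on f J \<and> (\<forall>i\<in>J. f i \<in> A i)"
      using tight(1) fin finA hall J
      by (intro less.hyps) (auto intro: psubset_card_mono)
    then obtain f where f: "inj_on f J" "\<And>i. i \<in> J \<Longrightarrow> f i \<in> A i"
      by blast
    \<comment> \<open>Hall's condition survives the removal of \<open>?U\<close>: the union over
      \<open>K \<union> J\<close> has at least \<open>card K + card J\<close> elements, and by
      tightness \<open>?U\<close> takes only \<open>card J\<close> of them.\<close>
    have "card K \<le> card (\<Union>((\<lambda>i. A i - ?U) ` K))" if K: "K \<subseteq> I - J" for K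
    proof -
      have "finite K" using K fin finite_subset by blast
      then have "card K + card J = card (K \<union> J)"
        using K J by (subst card_Un_disjoint) auto
      also have "\<dots> \<le> card (\<Union>(A ` (K \<union> J)))"
        using K J by (intro hall) auto
      also have "\<Union>(A ` (K \<union> J)) = \<Union>((\<lambda>i. A i - ?U) ` K) \<union> ?U"
        by auto
      also have "card \<dots> \<le> card (\<Union>((\<lambda>i. A i - ?U) ` K)) + card ?U"
        by (rule card_Un_le)
      finally show ?thesis using tight(3) by simp
    qed
    moreover have "card (I - J) < card I"
      using tight J fin by (intro psubset_card_mono) auto
    ultimately have "\<exists>g. inj_on g (I - J) \<and> (\<forall>i\<in>I - J. g i \<in> A i - ?U)"
      using fin finA by (intro less.hyps) auto
    then obtain g where g: "inj_on g (I - J)" "\<And>i. i \<in> I - J \<Longrightarrow> g i \<in> A i - ?U"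
      by blast
    have "inj_on (\<lambda>i. if i \<in> J then f i else g i) I"
    proof (rule inj_onI)
      fix i j
      assume "i \<in> I" "j \<in> I" "(if i \<in> J then f i else g i) = (if j \<in> J then f j else g j)"
      then show "i = j"
        using f(2)[of i] f(2)[of j] g(2)[of i] g(2)[of j] inj_onD[OF f(1), of i j] inj_onD[OF g(1), of i j]
        by (auto split: if_splits)
    qed
    then show ?thesis
      using f g by (intro exI[of _ "\<lambda>i. if i \<in> J then f i else g i"]) auto
  next
    case slack
    then obtain i where i: "i \<in> I" by blast
    have "A i \<noteq> {}"
      using hall[of "{i}"] i by auto
    then obtain x where x: "x \<in> A i" by blast
    have "card K \<le> card (\<Union>((\<lambda>j. A j - {x}) ` K))" if K: "K \<subseteq> I - {i}" for K
    proof (cases "K = {}")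
      case False
      \<comment> \<open>Since \<open>K\<close> misses \<open>i\<close>, it is a proper subfamily and
        has a spare element; deleting \<open>x\<close> costs no more than that.\<close>
      then have "card K < card (\<Union>(A ` K))"
        using K i by (intro slack) auto
      moreover have "\<Union>((\<lambda>j. A j - {x}) ` K) = \<Union>(A ` K) - {x}"
        by auto
      moreover have "card (\<Union>(A ` K)) - 1 \<le> card (\<Union>(A ` K) - {x})"
        using diff_card_le_card_Diff[of "{x}"] by simp
      ultimately show ?thesis by simp
    qed simp
    moreover have "card (I - {i}) < card I"
      using fin i by (rule card_Diff1_less)
    ultimately have "\<exists>g. inj_on g (I - {i}) \<and> (\<forall>j\<in>I - {i}. g j \<in> A j - {x})"
      using fin finA by (intro less.hyps) auto
    then obtain g where g: "inj_on g (I - {i})" "\<And>j. j \<in> I - {i} \<Longrightarrow> g j \<in> A j - {x}"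
      by blast
    have "inj_on (g(i := x)) I"
    proof (rule inj_onI)
      fix j l
      assume "j \<in> I" "l \<in> I" "(g(i := x)) j = (g(i := x)) l"
      then show "j = l"
        using g(2)[of j] g(2)[of l] inj_onD[OF g(1), of j l] by (auto split: if_splits)
    qed
    then show ?thesis
      using g x by (intro exI[of _ "g(i := x)"]) auto
  qed
qed

section \<open>Counting edges that contain given pairs\<close>

lemma le_binomial:
  assumes "1 \<le> m" "m < n"
  shows "n \<le> n choose m"
  using assms
proof (induction n arbitrary: m)
  case (Suc n)
  then obtain l where l: "m = Suc l" by (cases m) auto
  show ?case
  proof (cases "m = n")
    case True
    then show ?thesis by simp
  next
    case False
    then have "n \<le> n choose m" "1 \<le> n choose l"
      using Suc l by (auto simp: Suc_le_eq)
    then show ?thesis unfolding l binomial_Suc_Suc by linarith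
  qed
qed simp

lemma card_nsets_superset:
  assumes "finite V" "U \<subseteq> V" "card U \<le> k"
  shows "card {e \<in> nsets V k. U \<subseteq> e} = (card V - card U) choose (k - card U)"
proof -
  have U: "finite U" using assms finite_subset by blast
  have "bij_betw ((\<union>) U) (nsets (V - U) (k - card U)) {e \<in> nsets V k. U \<subseteq> e}"
  proof (rule bij_betwI[where g = "\<lambda>e. e - U"])
    show "(\<union>) U \<in> nsets (V - U) (k - card U) \<rightarrow> {e \<in> nsets V k. U \<subseteq> e}"
    proof
      fix d assume d: "d \<in> nsets (V - U) (k - card U)"
      then have "card (U \<union> d) = k"
        using U assms by (subst card_Un_disjoint) (auto simp: nsets_def)
      then show "U \<union> d \<in> {e \<in> nsets V k. U \<subseteq> e}"
        using d U assms by (auto simp: nsets_def)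
    qed
  qed (auto simp: nsets_def card_Diff_subset U)
  then have "card {e \<in> nsets V k. U \<subseteq> e} = card (nsets (V - U) (k - card U))"
    by (metis bij_betw_same_card)
  then show ?thesis
    using assms U by (simp add: card_nsets card_Diff_subset)
qed

text \<open>Double counting of the incidences \<open>p \<subseteq> e\<close> with \<open>p\<close>
  in \<open>P\<close> and \<open>e\<close> an edge through \<open>q\<close>: the left side bounds
  them from below pair by pair, the right side from above edge by edge.\<close>

lemma card_pairs_with_pair:
  assumes "finite V" "5 \<le> k" "k < card V" "q \<in> nsets V 2" "P \<subseteq> nsets V 2 - {q}"
  shows "card P * (card V - 4)
    \<le> ((k choose 2) - 1) * card {e \<in> nsets V k. q \<subseteq> e \<and> (\<exists>p\<in>P. p \<subseteq> e)}"
    (is "_ \<le> ?D * card ?M")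
proof -
  have finM: "finite ?M"
    using assms by (simp add: finite_imp_finite_nsets)
  have finP: "finite P"
    using assms by (meson finite_Diff finite_imp_finite_nsets finite_subset)
  have lower: "card V - 4 \<le> card {e \<in> ?M. p \<subseteq> e}" if p: "p \<in> P" for p
  proof -
    have q: "finite q" "card q = 2" "q \<subseteq> V" and p': "finite p" "card p = 2" "p \<subseteq> V" "p \<noteq> q"
      using p assms(4,5) by (auto simp: nsets_def)
    have u: "card (p \<union> q) \<le> 4"
      using card_Un_le[of p q] q p' by simp
    have "card V - 4 \<le> card V - card (p \<union> q)"
      using u by simp
    \<comment> \<open>Two pairs span at most 4 vertices, so \<open>5 \<le> k\<close> keeps the lower
      index positive, and \<open>k < card V\<close> keeps it below the upper one.\<close>
    also have "\<dots> \<le> (card V - card (p \<union> q)) choose (k - card (p \<union> q))"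
      using u assms by (intro le_binomial) auto
    also have "\<dots> = card {e \<in> nsets V k. p \<union> q \<subseteq> e}"
      using u q p' assms by (intro card_nsets_superset[symmetric]) auto
    also have "\<dots> \<le> card {e \<in> ?M. p \<subseteq> e}"
      using p assms(1) by (intro card_mono) (auto simp: finite_imp_finite_nsets)
    finally show ?thesis .
  qed
  have upper: "card {p \<in> P. p \<subseteq> e} \<le> ?D" if e: "e \<in> ?M" for e
  proof -
    have e': "finite e" "card e = k" "q \<in> nsets e 2"
      using e assms(4) by (auto simp: nsets_def)
    have "card {p \<in> P. p \<subseteq> e} \<le> card (nsets e 2 - {q})"
      using assms(5) e' by (intro card_mono) (auto simp: nsets_def finite_imp_finite_nsets)
    also have "\<dots> = ?D"
      using e' by (simp add: card_nsets)
    finally show ?thesis .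
  qed
  have "card P * (card V - 4) \<le> (\<Sum>p\<in>P. card {e \<in> ?M. p \<subseteq> e})"
    using lower by (metis (no_types, lifting) sum_bounded_below of_nat_id)
  also have "\<dots> = (\<Sum>p\<in>P. \<Sum>e | e \<in> ?M \<and> p \<subseteq> e. 1)"
    by simp
  also have "\<dots> = (\<Sum>e\<in>?M. \<Sum>p | p \<in> P \<and> p \<subseteq> e. 1)"
    using finP finM by (rule sum.swap_restrict)
  also have "\<dots> = (\<Sum>e\<in>?M. card {p \<in> P. p \<subseteq> e})"
    by simp
  also have "\<dots> \<le> card ?M * ?D"
    using upper by (metis (no_types, lifting) sum_bounded_above of_nat_id)
  finally show ?thesis by (simp add: mult.commute)
qed

text \<open>A single \<open>q\<close> in \<open>T\<close> suffices, because every edge through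
  \<open>q\<close> already contains a pair of \<open>T\<close>. The factor 2 is what makes the bound
  reach \<open>card S + card T\<close>.\<close>

lemma card_nsets_meeting_pair_sets:
  assumes V: "finite V" "5 \<le> k" "2 * (k choose 2) + 3 \<le> card V"
    and ST: "S \<subseteq> nsets V 2" "T \<subseteq> nsets V 2" "T \<noteq> {}" "card T \<le> card S"
  shows "2 * card S \<le> card {e \<in> nsets V k. (\<exists>p\<in>S. p \<subseteq> e) \<and> (\<exists>p\<in>T. p \<subseteq> e)}"
    (is "_ \<le> card ?E")
proof -
  obtain q where q: "q \<in> T" using ST by blast
  define D where "D = (k choose 2) - 1"
  have "k \<le> k choose 2"
    using V by (intro le_binomial) auto
  \<comment> \<open>In terms of \<open>D\<close> the assumed threshold is
    \<open>2 * D + 5 \<le> card V\<close>. The double count then gains a factor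
    \<open>(2 * D + 1) / D\<close>, slightly more than 2.\<close>
  then have D: "4 \<le> D" "2 * D + 1 \<le> card V - 4" and kV: "k < card V"
    using V by (auto simp: D_def)
  have finE: "finite ?E"
    using V by (simp add: finite_imp_finite_nsets)
  have count: "card P * (2 * D + 1) \<le> D * card {e \<in> nsets V k. q \<subseteq> e \<and> (\<exists>p\<in>P. p \<subseteq> e)}"
    if "P \<subseteq> nsets V 2 - {q}" for P
  proof -
    have "card P * (2 * D + 1) \<le> card P * (card V - 4)"
      using D by (intro mult_left_mono) auto
    also have "\<dots> \<le> D * card {e \<in> nsets V k. q \<subseteq> e \<and> (\<exists>p\<in>P. p \<subseteq> e)}"
      unfolding D_def using V kV ST q that by (intro card_pairs_with_pair) auto
    finally show ?thesis .
  qed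
  have mono: "D * card X \<le> D * card ?E" if "X \<subseteq> ?E" for X
    using that finE by (intro mult_left_mono card_mono) auto
  have "D * (2 * card S) \<le> D * card ?E"
  proof (cases "q \<in> S")
    case False
    have "D * (2 * card S) \<le> card S * (2 * D + 1)"
      by (simp add: algebra_simps)
    also have "\<dots> \<le> D * card {e \<in> nsets V k. q \<subseteq> e \<and> (\<exists>p\<in>S. p \<subseteq> e)}"
      using ST False by (intro count) auto
    also have "\<dots> \<le> D * card ?E"
      using q by (intro mono) auto
    finally show ?thesis .
  next
    \<comment> \<open>Here every edge containing \<open>q\<close> meets both sets, so we may count with all pairs
      instead of \<open>S\<close>.\<close>
    case True
    let ?P = "nsets V 2 - {q}"
    have fin2: "finite (nsets V 2)"
      using V by (simp add: finite_imp_finite_nsets)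
    have cardP: "card (nsets V 2) = card ?P + 1"
      using card.remove[OF fin2, of q] ST q by auto
    have "card V \<le> card (nsets V 2)"
      using V kV by (simp add: card_nsets le_binomial)
    \<comment> \<open>With this many pairs, the surplus 1 in the factor \<open>2 * D + 1\<close>
      adds up to at least \<open>2 * D\<close>, which makes up for \<open>q\<close> being absent
      from \<open>?P\<close>.\<close>
    then have P: "2 * D \<le> card ?P"
      using cardP D by simp
    have "D * (2 * card S) \<le> D * (2 * (card ?P + 1))"
      using card_mono[OF fin2 ST(1)] cardP by (intro mult_left_mono) auto
    also have "\<dots> \<le> card ?P * (2 * D + 1)"
      using P by (simp add: algebra_simps)
    also have "\<dots> \<le> D * card {e \<in> nsets V k. q \<subseteq> e \<and> (\<exists>p\<in>?P. p \<subseteq> e)}"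
      by (intro count) auto
    also have "\<dots> \<le> D * card ?E"
      using q True by (intro mono) auto
    finally show ?thesis .
  qed
  then show ?thesis using D by simp
qed

section \<open>Hall's condition for one of the two colours\<close>

lemma monochromatic_hall_condition:
  fixes c :: "'a set \<Rightarrow> 'b"
  assumes V: "finite V" "5 \<le> k" "2 * (k choose 2) + 3 \<le> card V"
    and c: "c \<in> nsets V k \<rightarrow> {a, b}"
  shows "\<exists>i\<in>{a, b}. \<forall>S \<subseteq> nsets V 2. card S \<le> card {e \<in> nsets V k. c e = i \<and> (\<exists>p\<in>S. p \<subseteq> e)}"
proof (rule ccontr)
  let ?N = "\<lambda>i S. {e \<in> nsets V k. c e = i \<and> (\<exists>p\<in>S. p \<subseteq> e)}"
  assume "\<not> ?thesis"
  then obtain S T where S: "S \<subseteq> nsets V 2" "card (?N a S) < card S"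
    and T: "T \<subseteq> nsets V 2" "card (?N b T) < card T"
    by (auto simp: not_le)
  let ?E = "{e \<in> nsets V k. (\<exists>p\<in>S. p \<subseteq> e) \<and> (\<exists>p\<in>T. p \<subseteq> e)}"
  have ne: "S \<noteq> {}" "T \<noteq> {}"
    using S T by auto
  have "finite (nsets V k)"
    using V by (simp add: finite_imp_finite_nsets)
  \<comment> \<open>An edge of \<open>?E\<close> lies in \<open>?N a S\<close> if its colour is
    \<open>a\<close>, and in \<open>?N b T\<close> if it is \<open>b\<close>.\<close>
  then have "card ?E \<le> card (?N a S \<union> ?N b T)"
    using c by (intro card_mono) auto
  also have "\<dots> \<le> card (?N a S) + card (?N b T)"
    by (rule card_Un_le)
  finally have less: "card ?E < card S + card T"
    using S T by simp
  show False
  \<comment> \<open>The larger of the two sets is the one counted, since twice its size is at least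
    \<open>card S + card T\<close>.\<close>
  proof (cases "card T \<le> card S")
    case True
    then show False
      using card_nsets_meeting_pair_sets[OF V S(1) T(1)] ne less by simp
  next
    case False
    moreover have "?E = {e \<in> nsets V k. (\<exists>p\<in>T. p \<subseteq> e) \<and> (\<exists>p\<in>S. p \<subseteq> e)}"
      by auto
    ultimately show False
      using card_nsets_meeting_pair_sets[OF V T(1) S(1)] ne less by simp
  qed
qed

section \<open>Berge copies and the Ramsey number\<close>

lemma isomorphic_refl: "isomorphic H H"
  unfolding isomorphic_def by (intro exI[of _ id]) auto

text \<open>A system of distinct representatives for the edges of colour \<open>i\<close> above each
  pair is the map \<psi> of a Berge copy whose \<phi> is the identity on all \<open>t\<close>
  vertices.\<close>

lemma contains_coloured_berge_completeI:
  assumes "\<And>S. S \<subseteq> nsets {..<t} 2 \<Longrightarrow>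
    card S \<le> card {e \<in> nsets {..<t} k. c e = i \<and> (\<exists>p\<in>S. p \<subseteq> e)}"
  shows "contains_coloured (complete_hypergraph k t) c i (berge k (complete_graph t))"
proof -
  let ?A = "\<lambda>p. {e \<in> nsets {..<t} k. c e = i \<and> p \<subseteq> e}"
  have "\<exists>\<psi>. inj_on \<psi> (nsets {..<t} 2) \<and> (\<forall>p\<in>nsets {..<t} 2. \<psi> p \<in> ?A p)"
  proof (rule hall_marriage)
    fix S assume "S \<subseteq> nsets {..<t} 2"
    moreover have "\<Union>(?A ` S) = {e \<in> nsets {..<t} k. c e = i \<and> (\<exists>p\<in>S. p \<subseteq> e)}"
      by auto
    ultimately show "card S \<le> card (\<Union>(?A ` S))"
      using assms by simp
  qed (simp_all add: finite_imp_finite_nsets)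
  then obtain \<psi> where \<psi>: "inj_on \<psi> (nsets {..<t} 2)"
    "\<And>p. p \<in> nsets {..<t} 2 \<Longrightarrow> \<psi> p \<in> ?A p"
    by blast
  define H where "H = ({..<t}, \<psi> ` nsets {..<t} 2)"
  have edgesH: "edges H \<subseteq> nsets {..<t} k"
    using \<psi>(2) by (auto simp: H_def)
  have "H \<in> berge k (complete_graph t)"
    unfolding berge_def
  proof (intro CollectI conjI exI)
    show "uniform_hypergraph k H"
      using edgesH by (simp add: uniform_hypergraph_def H_def)
    show "inj_on id (verts (complete_graph t))"
      by simp
    show "id ` verts (complete_graph t) \<subseteq> verts H"
      by (simp add: H_def complete_graph_def complete_hypergraph_def)
    show "bij_betw \<psi> (edges (complete_graph t)) (edges H)"
      using \<psi> by (simp add: H_def complete_graph_def complete_hypergraph_def bij_betw_def)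
    show "\<forall>u v. {u, v} \<in> edges (complete_graph t) \<longrightarrow> {id u, id v} \<subseteq> \<psi> {u, v}"
    proof (intro allI impI)
      fix u v assume "{u, v} \<in> edges (complete_graph t)"
      then show "{id u, id v} \<subseteq> \<psi> {u, v}"
        using \<psi>(2)[of "{u, v}"] by (simp add: complete_graph_def complete_hypergraph_def)
    qed
  qed
  moreover have "subhypergraph H (complete_hypergraph k t)"
    using edgesH by (auto simp: subhypergraph_def H_def complete_hypergraph_def nsets_def)
  moreover have "\<forall>e\<in>edges H. c e = i"
    using \<psi>(2) by (auto simp: H_def)
  ultimately show ?thesis
    unfolding contains_coloured_def using isomorphic_refl by blast
qed

text \<open>The injection \<phi> alone requires \<open>t\<close> vertices, whatever the colouring;
  this gives the lower bound on the Ramsey number.\<close>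

lemma contains_coloured_berge_complete_le:
  assumes "contains_coloured (complete_hypergraph k N) c i (berge k (complete_graph t))"
  shows "t \<le> N"
proof -
  obtain H F where H: "subhypergraph H (complete_hypergraph k N)" "isomorphic H F"
    and F: "F \<in> berge k (complete_graph t)"
    using assms by (auto simp: contains_coloured_def)
  obtain f where f: "bij_betw f (verts H) (verts F)"
    using H by (auto simp: isomorphic_def)
  obtain \<phi> where \<phi>: "inj_on \<phi> {..<t}" "\<phi> ` {..<t} \<subseteq> verts F" and fin: "finite (verts F)"
    using F by (auto simp: berge_def uniform_hypergraph_def complete_graph_def
        complete_hypergraph_def)
  have "t \<le> card (verts F)"
    using card_inj_on_le[OF \<phi> fin] by simp
  also have "\<dots> = card (verts H)"
    using f by (simp add: bij_betw_same_card)
  also have "\<dots> \<le> card {..<N}"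
    using H by (intro card_mono) (auto simp: subhypergraph_def complete_hypergraph_def)
  finally show ?thesis by simp
qed

lemma ramsey_number_berge_complete:
  assumes "5 \<le> k" "2 * (k choose 2) + 3 \<le> t"
  shows "ramsey_number k (berge k (complete_graph t)) (berge k (complete_graph t)) = enat t"
  unfolding ramsey_number_def
proof (rule Inf_eqI)
  fix n assume "n \<in> {enat N |N. ramsey_arrow N k (berge k (complete_graph t))
    (berge k (complete_graph t))}"
  then obtain N where n: "n = enat N"
    and arrow: "ramsey_arrow N k (berge k (complete_graph t)) (berge k (complete_graph t))"
    by blast
  \<comment> \<open>Any colouring would do here; the constant one serves to extract a Berge copy
    from the arrow relation.\<close>
  have "(\<lambda>_. 0) \<in> edges (complete_hypergraph k N) \<rightarrow> {0, 1::nat}"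
    by simp
  then have "t \<le> N"
    using arrow contains_coloured_berge_complete_le unfolding ramsey_arrow_def by blast
  then show "enat t \<le> n"
    by (simp add: n)
next
  fix y
  assume lb: "\<And>n. n \<in> {enat N |N. ramsey_arrow N k (berge k (complete_graph t))
    (berge k (complete_graph t))} \<Longrightarrow> y \<le> n"
  \<comment> \<open>As \<open>t\<close> itself belongs to the set, no lower bound \<open>y\<close>
    of the set exceeds it.\<close>
  have "ramsey_arrow t k (berge k (complete_graph t)) (berge k (complete_graph t))"
    unfolding ramsey_arrow_def
  proof
    fix c :: "nat set \<Rightarrow> nat"
    assume "c \<in> edges (complete_hypergraph k t) \<rightarrow> {0, 1}"
    then have "c \<in> nsets {..<t} k \<rightarrow> {0, 1}"
      by (simp add: complete_hypergraph_def)
    then obtain i where i: "i \<in> {0, 1}" "\<And>S. S \<subseteq> nsets {..<t} 2 \<Longrightarrow>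
        card S \<le> card {e \<in> nsets {..<t} k. c e = i \<and> (\<exists>p\<in>S. p \<subseteq> e)}"
      using monochromatic_hall_condition[of "{..<t}" k c 0 1] assms by auto
    then have "contains_coloured (complete_hypergraph k t) c i (berge k (complete_graph t))"
      by (intro contains_coloured_berge_completeI)
    then show "contains_coloured (complete_hypergraph k t) c 0 (berge k (complete_graph t)) \<or>
        contains_coloured (complete_hypergraph k t) c 1 (berge k (complete_graph t))"
      using i(1) by auto
  qed
  then show "y \<le> enat t"
    by (intro lb) blast
qed

theorem theorem1p7:
  shows "(\<forall>k\<ge>5. \<exists>t0. \<forall>t\<ge>t0.
            ramsey_number k (berge k (complete_graph t)) (berge k (complete_graph t)) = enat t)
       \<and> (\<forall>t\<ge>23.
            ramsey_number 5 (berge 5 (complete_graph t)) (berge 5 (complete_graph t)) = enat t)"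
proof (intro conjI allI impI)
  fix k :: nat assume "5 \<le> k"
  \<comment> \<open>The witness is \<open>2 * (k choose 2) + 3\<close>.\<close>
  then show "\<exists>t0. \<forall>t\<ge>t0.
      ramsey_number k (berge k (complete_graph t)) (berge k (complete_graph t)) = enat t"
    using ramsey_number_berge_complete by blast
next
  fix t :: nat assume "23 \<le> t"
  \<comment> \<open>For \<open>k = 5\<close> the threshold is 2 * 10 + 3 = 23.\<close>
  moreover have "5 choose 2 = (10::nat)"
    by (simp add: choose_two)
  ultimately show
    "ramsey_number 5 (berge 5 (complete_graph t)) (berge 5 (complete_graph t)) = enat t"
    by (intro ramsey_number_berge_complete) auto
qed

end
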